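(* Let $\mathcal{F} \in \mathbb{S}^{n^{2d}}$ be an even-order super-symmetric complex tensor. Then its M-rank, symmetric M-rank and strongly symmetric M-rank coincide: $$\operatorname{rank}_{M}(\mathcal{F})=\operatorname{rank}_{SM}(\mathcal{F})=\operatorname{rank}_{SSM}(\mathcal{F}).$$
   Context: $\mathbb{C}^{n^{k}}$ denotes the space of $k$-th order complex tensors of dimension $n\times\cdots\times n$ ($k$ times). A tensor $\mathcal{F}\in\mathbb{C}^{n^k}$ is super-symmetric if its entries are invariant under every permutation of its indices; $\mathbb{S}^{n^{k}}\subset\mathbb{C}^{n^k}$ denotes the set of super-symmetric tensors. $\otimes$ is the outer product: $(\mathcal{A}\otimes\mathcal{B})_{i_1\cdots i_{k+\ell}}=\mathcal{A}_{i_1\cdots i_k}\mathcal{B}_{i_{k+1}\cdots i_{k+\ell}}$. The square unfolding of a tensor $\mathcal{F}\in\mathbb{C}^{n_1\times\cdots\times n_{2d}}$ is the matrix $\boldsymbol{M}(\mathcal{F})\in\mathbb{C}^{(n_1\cdots n_d)\times(n_{d+1}\cdots n_{2d})}$ whose rows are indexed by $(i_1,\dots,i_d)$, whose columns are indexed by $(i_{d+1},\dots,i_{2d})$, and whose corresponding entry is $\mathcal{F}_{i_1\cdots i_{2d}}$. For super-symmetric $\mathcal{F}\in\mathbb{S}^{n^{2d}}$ all square unfoldings obtained after permuting the indices have the same rank, and: - the M-rank $\operatorname{rank}_M(\mathcal{F})$ is $\operatorname{rank}(\boldsymbol{M}(\mathcal{F}))$, equivalently the smallest integer $r$ such that $\mathcal{F}=\sum_{i=1}^r\mathcal{A}^i\otimes\mathcal{B}^i$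 with $\mathcal{A}^i,\mathcal{B}^i\in\mathbb{C}^{n^d}$; - the symmetric M-rank $\operatorname{rank}_{SM}(\mathcal{F})$ is the rank of the symmetric matrix $\boldsymbol{M}(\mathcal{F})$, equivalently the smallest integer $r$ such that $\mathcal{F}=\sum_{i=1}^r\mathcal{B}^i\otimes\mathcal{B}^i$ with $\mathcal{B}^i\in\mathbb{C}^{n^d}$; - the strongly symmetric M-rank $\operatorname{rank}_{SSM}(\mathcal{F})$ is the smallest integer $r$ such that $\mathcal{F}=\sum_{i=1}^r\mathcal{A}^i\otimes\mathcal{A}^i$ with $\mathcal{A}^i\in\mathbb{S}^{n^d}$. *)

theory Defs
  imports "HOL-Analysis.Analysis"
begin

text \<open>
  A tensor of order \<open>CARD('k)\<close> and dimension \<open>CARD('n)\<close> in every mode is a vector of entries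
  indexed by the multi-indices \<open>'k \<Rightarrow> 'n\<close>, where \<open>'k\<close> is the type of index positions.
  Order \<open>2d\<close> is expressed by the position type \<open>'d + 'd\<close>: the summand \<open>Inl\<close> holds the first
  \<open>d\<close> positions and \<open>Inr\<close> the last \<open>d\<close> positions.
\<close>

type_synonym ('n, 'k) tensor = "complex ^ ('k \<Rightarrow> 'n)"

definition super_symmetric :: "('n::finite, 'k::finite) tensor \<Rightarrow> bool" where
  "super_symmetric F \<longleftrightarrow> (\<forall>\<pi>. bij \<pi> \<longrightarrow> (\<forall>i. F $ (i \<circ> \<pi>) = F $ i))"

definition outer_product ::
  "('n::finite, 'k::finite) tensor \<Rightarrow> ('n, 'l::finite) tensor \<Rightarrow> ('n, 'k + 'l) tensor"
  (infixr "\<otimes>" 75) where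
  "A \<otimes> B = (\<chi> i. A $ (i \<circ> Inl) * B $ (i \<circ> Inr))"

definition square_unfolding ::
  "('n::finite, 'd::finite + 'd) tensor \<Rightarrow> complex ^ ('d \<Rightarrow> 'n) ^ ('d \<Rightarrow> 'n)" where
  "square_unfolding F = (\<chi> i j. F $ case_sum i j)"

definition M_rank :: "('n::finite, 'd::finite + 'd) tensor \<Rightarrow> nat" where
  "M_rank F = rank (square_unfolding F)"

text \<open>
  In the next two definitions, \<open>Inf\<close> of a nonempty set of natural numbers is its minimum, and
  \<open>Inf {} = 0\<close>. If no decomposition of \<open>F\<close> existed, then \<open>F \<noteq> 0\<close> (as \<open>0\<close> is the empty sum), so
  the convention would give a value different from \<open>M_rank F\<close>; equality with \<open>M_rank F\<close> thus
  includes the existence of a decomposition.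
\<close>

definition symmetric_M_rank :: "('n::finite, 'd::finite + 'd) tensor \<Rightarrow> nat" where
  "symmetric_M_rank F =
     Inf {r. \<exists>B :: nat \<Rightarrow> ('n, 'd) tensor. F = (\<Sum>i<r. B i \<otimes> B i)}"

definition strongly_symmetric_M_rank :: "('n::finite, 'd::finite + 'd) tensor \<Rightarrow> nat" where
  "strongly_symmetric_M_rank F =
     Inf {r. \<exists>A :: nat \<Rightarrow> ('n, 'd) tensor.
               (\<forall>i<r. super_symmetric (A i)) \<and> F = (\<Sum>i<r. A i \<otimes> A i)}"

end

theory Submission
  imports Defs
begin

text \<open>
  The square unfolding \<open>M\<close> of a super-symmetric tensor is a symmetric complex matrix, and a
  decomposition of the tensor into squares \<open>B \<otimes> B\<close> is a decomposition \<open>M = (\<Sum>k<r. b\<^sub>k b\<^sub>k\<^sup>T)\<close>.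
  Any such decomposition has \<open>r \<ge> rank M\<close> (\<open>rank_le_number_of_dyads\<close>). Conversely, Lagrange's
  reduction of a quadratic form to a sum of squares splits off one dyad \<open>b b\<^sup>T\<close> at a time with
  \<open>b = M x / sqrt (x\<^sup>T M x)\<close>, lowering the rank at every step
  (\<open>rank_decreases_by_Lagrange_step\<close>); square roots exist as the scalars are complex.

  The point for strong symmetry is that all \<open>b\<^sub>k\<close> produced this way lie in the row space of \<open>M\<close>
  (\<open>symmetric_matrix_as_sum_of_dyads\<close>). The rows of \<open>M\<close> are the slices of the tensor with the first
  half of the indices fixed; they are super-symmetric, and super-symmetric tensors form a subspace
  (\<open>row_space_super_symmetric\<close>). So one and the same decomposition of length at most \<open>rank M\<close>
  realises the minimum in both the symmetric and the strongly symmetric M-rank.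
\<close>

section \<open>Symmetric matrices as sums of dyads\<close>

lemma rank_le_number_of_dyads:
  fixes M :: "'a::field^'n^'m"
  assumes "\<And>i j. M $ i $ j = (\<Sum>k<r. a k $ i * b k $ j)"
  shows "rank M \<le> r"
proof -
  have "row i M = (\<Sum>k<r. a k $ i *s b k)" for i
    by (simp add: vec_eq_iff row_def assms)
  then have "row i M \<in> vec.span (b ` {..<r})" for i
    by (simp only:) (intro vec.span_sum vec.span_scale vec.span_base imageI)
  then have "rows M \<subseteq> vec.span (b ` {..<r})"
    by (auto simp: rows_def)
  then have "vec.dim (rows M) \<le> card (b ` {..<r})"
    by (rule vec.dim_le_card) simp
  also have "\<dots> \<le> r"
    using card_image_le[of "{..<r}" b] by simp
  finally show ?thesis
    by (simp add: row_rank_def_gen)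
qed

text \<open>Polarization: the off-diagonal entries are recovered from the values of the quadratic form at
  \<open>e\<^sub>i + e\<^sub>j\<close>, which needs division by 2.\<close>

lemma exists_nonisotropic_vector:
  fixes M :: "'a::field_char_0^'n::finite^'n"
  assumes sym: "transpose M = M" and "M \<noteq> 0"
  shows "\<exists>x. (\<Sum>i\<in>UNIV. x $ i * (M *v x) $ i) \<noteq> 0"
proof -
  have axis_sum: "(\<Sum>k\<in>UNIV. axis i 1 $ k * f k) = f i" for i and f :: "'n \<Rightarrow> 'a"
    by (simp add: axis_def if_distribR[of _ "(*)"] if_distrib[of "\<lambda>a. a * _"] cong: if_cong)
  have M_axis: "(M *v axis i 1) $ k = M $ k $ i" for i k
    using axis_sum[of i "\<lambda>j. M $ k $ j"] by (simp add: matrix_vector_mult_def mult.commute)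
  show ?thesis
  proof (cases "\<exists>i. M $ i $ i \<noteq> 0")
    case True
    then obtain i where "M $ i $ i \<noteq> 0" ..
    then show ?thesis
      by (intro exI[of _ "axis i 1"]) (simp only: axis_sum M_axis not_False_eq_True)
  next
    case False
    then have diag: "M $ i $ i = 0" for i by simp
    obtain i j where ij: "M $ i $ j \<noteq> 0"
      using \<open>M \<noteq> 0\<close> by (auto simp: vec_eq_iff)
    have swap: "M $ j $ i = M $ i $ j"
      using arg_cong[OF sym, of "\<lambda>A. A $ i $ j"] by (simp add: transpose_def)
    have "(\<Sum>k\<in>UNIV. (axis i 1 + axis j 1) $ k * (M *v (axis i 1 + axis j 1)) $ k)
        = 2 * M $ i $ j"
      by (simp only: vector_add_component distrib_right sum.distrib axis_sum
          matrix_vector_right_distrib M_axis diag swap) simp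
    with ij show ?thesis
      by (metis mult_eq_0_iff zero_neq_numeral)
  qed
qed

lemma matrix_vector_mult_in_row_space:
  fixes M :: "'a::field^'n^'n"
  assumes "transpose M = M"
  shows "M *v x \<in> vec.span (rows M)"
  using matrix_vector_mult_in_columnspace_gen[of M x] rows_transpose[of M] assms by simp

lemma Lagrange_step_in_row_space:
  fixes M :: "'a::field^'n^'n"
  assumes "transpose M = M"
    and N: "\<And>i j. N $ i $ j = M $ i $ j - c * (M *v x) $ i * (M *v x) $ j"
  shows "vec.span (rows N) \<subseteq> vec.span (rows M)"
proof -
  have "row i N = row i M - (c * (M *v x) $ i) *s (M *v x)" for i
    by (simp add: vec_eq_iff row_def N)
  moreover have "row i M \<in> vec.span (rows M)" for i
    by (auto simp: rows_def intro: vec.span_base)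
  ultimately have "rows N \<subseteq> vec.span (rows M)"
    using matrix_vector_mult_in_row_space[OF assms(1)]
    by (auto simp: rows_def intro!: vec.span_diff vec.span_scale)
  then show ?thesis
    by (simp add: vec.span_minimal)
qed

text \<open>Subtracting the dyad makes every row orthogonal to \<open>x\<close>, while \<open>M *v x\<close>, which lies in the row
  space of \<open>M\<close>, is not orthogonal to \<open>x\<close>; hence the row space shrinks.\<close>

lemma rank_decreases_by_Lagrange_step:
  fixes M N :: "'a::field^'n::finite^'n"
  assumes sym: "transpose M = M"
    and q: "q = (\<Sum>i\<in>UNIV. x $ i * (M *v x) $ i)" "q \<noteq> 0"
    and N: "\<And>i j. N $ i $ j = M $ i $ j - inverse q * (M *v x) $ i * (M *v x) $ j"
  shows "rank N < rank M"
proof -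
  let ?H = "{y. (\<Sum>i\<in>UNIV. x $ i * y $ i) = 0}"
  have "vec.subspace ?H"
    by (rule vec.subspaceI)
      (simp_all add: distrib_left sum.distrib mult.left_commute flip: sum_distrib_left)
  moreover have "row i N \<in> ?H" for i
  proof -
    have "(\<Sum>j\<in>UNIV. x $ j * row i N $ j)
        = (M *v x) $ i - inverse q * (M *v x) $ i * q"
    proof -
      have "(\<Sum>j\<in>UNIV. x $ j * row i N $ j)
          = (\<Sum>j\<in>UNIV. M $ i $ j * x $ j - inverse q * (M *v x) $ i * (x $ j * (M *v x) $ j))"
        by (simp add: N row_def right_diff_distrib mult_ac)
      also have "\<dots> = (\<Sum>j\<in>UNIV. M $ i $ j * x $ j) - inverse q * (M *v x) $ i * q"
        by (simp only: sum_subtractf sum_distrib_left[symmetric] q(1)[symmetric])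
      finally show ?thesis
        by (simp add: matrix_vector_mult_def[of M x])
    qed
    then show ?thesis
      using q(2) by simp
  qed
  ultimately have "vec.span (rows N) \<subseteq> ?H"
    by (intro vec.span_minimal) (auto simp: rows_def)
  moreover have "M *v x \<notin> ?H"
    using q by simp
  ultimately have "vec.span (rows N) \<subset> vec.span (rows M)"
    using Lagrange_step_in_row_space[OF sym N] matrix_vector_mult_in_row_space[OF sym, of x] by blast
  then show ?thesis
    by (simp add: row_rank_def_gen vec.dim_psubset)
qed

lemma symmetric_matrix_as_sum_of_dyads:
  fixes M :: "complex^'n::finite^'n"
  assumes "transpose M = M"
  shows "\<exists>r\<le>rank M. \<exists>b. (\<forall>k<r. b k \<in> vec.span (rows M)) \<and>
           (\<forall>i j. M $ i $ j = (\<Sum>k<r. b k $ i * b k $ j))"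
  using assms
proof (induction "rank M" arbitrary: M rule: less_induct)
  case less
  show ?case
  proof (cases "M = 0")
    case True
    then show ?thesis
      by (intro exI[of _ 0]) simp
  next
    case False
    obtain x where x: "(\<Sum>i\<in>UNIV. x $ i * (M *v x) $ i) \<noteq> 0"
      using exists_nonisotropic_vector[OF less.prems False] by blast
    define q where "q = (\<Sum>i\<in>UNIV. x $ i * (M *v x) $ i)"
    define N :: "complex^'n^'n"
      where "N = (\<chi> i j. M $ i $ j - inverse q * (M *v x) $ i * (M *v x) $ j)"
    have N: "N $ i $ j = M $ i $ j - inverse q * (M *v x) $ i * (M *v x) $ j" for i j
      by (simp add: N_def)
    have "M $ i $ j = M $ j $ i" for i j
      using arg_cong[OF less.prems, of "\<lambda>A. A $ j $ i"] by (simp add: transpose_def)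
    then have symN: "transpose N = N"
      by (simp add: vec_eq_iff transpose_def N)
    have rank_N: "rank N < rank M"
      using rank_decreases_by_Lagrange_step[OF less.prems q_def _ N] x by (simp add: q_def)
    from less.hyps[OF rank_N symN] obtain r b
      where r: "r \<le> rank N" and b: "\<forall>k<r. b k \<in> vec.span (rows N)"
        and Nb: "\<forall>i j. N $ i $ j = (\<Sum>k<r. b k $ i * b k $ j)"
      by blast
    define w where "w = inverse (csqrt q) *s (M *v x)"
    have w: "w $ i * w $ j = inverse q * (M *v x) $ i * (M *v x) $ j" for i j
    proof -
      have "inverse (csqrt q) * inverse (csqrt q) = inverse q"
        by (metis inverse_mult_distrib power2_csqrt power2_eq_square)
      moreover have "w $ i * w $ j
          = (inverse (csqrt q) * inverse (csqrt q)) * (M *v x) $ i * (M *v x) $ j"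
        unfolding w_def vector_scalar_mult_def vec_lambda_beta by (simp only: mult_ac)
      ultimately show ?thesis
        by (simp only:)
    qed
    have "w \<in> vec.span (rows M)"
      unfolding w_def by (intro vec.span_scale matrix_vector_mult_in_row_space less.prems)
    then have "\<forall>k<Suc r. (b(r := w)) k \<in> vec.span (rows M)"
      using b Lagrange_step_in_row_space[OF less.prems N] by (auto simp: less_Suc_eq)
    moreover have "M $ i $ j = (\<Sum>k<Suc r. (b(r := w)) k $ i * (b(r := w)) k $ j)" for i j
    proof -
      have "(\<Sum>k<Suc r. (b(r := w)) k $ i * (b(r := w)) k $ j) = N $ i $ j + w $ i * w $ j"
        using Nb by simp
      then show ?thesis
        by (simp add: N w)
    qed
    ultimately show ?thesis
      using r rank_N by (intro exI[of _ "Suc r"] conjI exI[of _ "b(r := w)"]) auto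
  qed
qed

section \<open>Square unfoldings of super-symmetric tensors\<close>

lemma sum_outer_product_iff_unfolding:
  fixes F :: "('n::finite, 'd::finite + 'd) tensor"
  shows "F = (\<Sum>k<r. B k \<otimes> B k) \<longleftrightarrow>
    (\<forall>i j. square_unfolding F $ i $ j = (\<Sum>k<r. B k $ i * B k $ j))"
proof -
  have split: "(\<forall>h. P h) \<longleftrightarrow> (\<forall>i j. P (case_sum i j))" for P :: "('d + 'd \<Rightarrow> 'n) \<Rightarrow> bool"
    by (metis surjective_sum)
  show ?thesis
    unfolding vec_eq_iff split
    by (simp add: square_unfolding_def outer_product_def o_def)
qed

lemma transpose_square_unfolding:
  fixes F :: "('n::finite, 'd::finite + 'd) tensor"
  assumes "super_symmetric F"
  shows "transpose (square_unfolding F) = square_unfolding F"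
proof -
  let ?s = "case_sum Inr Inl :: 'd + 'd \<Rightarrow> 'd + 'd"
  have "?s \<circ> ?s = id"
    by (auto simp: fun_eq_iff split: sum.split)
  then have "bij ?s"
    using o_bij by blast
  moreover have "case_sum i j \<circ> ?s = case_sum j i" for i j :: "'d \<Rightarrow> 'n"
    by (auto simp: fun_eq_iff split: sum.split)
  ultimately have "F $ case_sum j i = F $ case_sum i j" for i j
    using assms unfolding super_symmetric_def by metis
  then show ?thesis
    by (simp add: vec_eq_iff transpose_def square_unfolding_def)
qed

text \<open>A permutation of the last \<open>d\<close> positions extends to one of all \<open>2d\<close> positions that fixes the
  first \<open>d\<close>, so each slice inherits the symmetry of the whole tensor.\<close>

lemma row_space_super_symmetric:
  fixes F :: "('n::finite, 'd::finite + 'd) tensor"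
  assumes "super_symmetric F" and "A \<in> vec.span (rows (square_unfolding F))"
  shows "super_symmetric A"
proof -
  have "super_symmetric (row i (square_unfolding F))" for i
    unfolding super_symmetric_def
  proof (intro allI impI)
    fix \<pi> :: "'d \<Rightarrow> 'd" and j :: "'d \<Rightarrow> 'n"
    assume "bij \<pi>"
    let ?p = "map_sum id \<pi> :: 'd + 'd \<Rightarrow> 'd + 'd"
    have "bij ?p"
      by (rule o_bij[of "map_sum id (inv \<pi>)"])
        (use \<open>bij \<pi>\<close> in \<open>simp_all add: map_sum.comp map_sum.id bij_is_inj
            bij_is_surj surj_iff[THEN iffD1]\<close>)
    moreover have "case_sum i j \<circ> ?p = case_sum i (j \<circ> \<pi>)"
      by (auto simp: fun_eq_iff split: sum.split)
    ultimately have "F $ case_sum i (j \<circ> \<pi>) = F $ case_sum i j"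
      using assms(1) unfolding super_symmetric_def by metis
    then show "row i (square_unfolding F) $ (j \<circ> \<pi>) = row i (square_unfolding F) $ j"
      by (simp add: row_def square_unfolding_def)
  qed
  then have "rows (square_unfolding F) \<subseteq> Collect super_symmetric"
    by (auto simp: rows_def)
  moreover have "vec.subspace (Collect (super_symmetric :: ('n, 'd) tensor \<Rightarrow> bool))"
    by (rule vec.subspaceI) (auto simp: super_symmetric_def)
  ultimately have "vec.span (rows (square_unfolding F)) \<subseteq> Collect super_symmetric"
    by (rule vec.span_minimal)
  with assms(2) show ?thesis
    by blast
qed

section \<open>Equality of the three ranks\<close>

theorem mainTheorem1:
  fixes F :: "('n::finite, 'd::finite + 'd) tensor"
  assumes "super_symmetric F"
  shows "M_rank F = symmetric_M_rank F \<and>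
         symmetric_M_rank F = strongly_symmetric_M_rank F"
proof -
  define S where "S = {r. \<exists>B :: nat \<Rightarrow> ('n, 'd) tensor. F = (\<Sum>i<r. B i \<otimes> B i)}"
  define T where "T = {r. \<exists>A :: nat \<Rightarrow> ('n, 'd) tensor.
    (\<forall>i<r. super_symmetric (A i)) \<and> F = (\<Sum>i<r. A i \<otimes> A i)}"
  have "T \<subseteq> S"
    by (auto simp: S_def T_def)
  have lower: "M_rank F \<le> r" if "r \<in> S" for r
  proof -
    from that obtain B :: "nat \<Rightarrow> ('n, 'd) tensor"
      where "\<And>i j. square_unfolding F $ i $ j = (\<Sum>k<r. B k $ i * B k $ j)"
      unfolding S_def sum_outer_product_iff_unfolding by blast
    then show ?thesis
      unfolding M_rank_def by (rule rank_le_number_of_dyads)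
  qed
  obtain r b where "r \<le> M_rank F"
    and b: "\<forall>k<r. b k \<in> vec.span (rows (square_unfolding F))"
    and Fb: "F = (\<Sum>k<r. b k \<otimes> b k)"
    using symmetric_matrix_as_sum_of_dyads[OF transpose_square_unfolding[OF assms]]
    unfolding M_rank_def sum_outer_product_iff_unfolding by blast
  have "r \<in> T"
    using b Fb row_space_super_symmetric[OF assms] by (auto simp: T_def)
  then have "M_rank F \<in> T"
    using lower[of r] \<open>T \<subseteq> S\<close> \<open>r \<le> M_rank F\<close> by (metis le_antisym subsetD)
  then have "Inf T = M_rank F" "Inf S = M_rank F"
    using lower \<open>T \<subseteq> S\<close> by (auto intro!: cInf_eq_minimum)
  then show ?thesis
    by (simp add: symmetric_M_rank_def strongly_symmetric_M_rank_def flip: S_def T_def)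
qed

end
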